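(* For every complex number $a$ with $a\notin\{-\tfrac14,-\tfrac34,-\tfrac54,\dots\}$, $$F_1\left(2a;\,a+\tfrac12,\,4a-1;\,2a+\tfrac12;\,\tfrac1{81},\tfrac16\right)=\frac{3^{8a}}{2^{2a}5^{5a}}\,\frac{\sqrt\pi\,\Gamma(2a+1/2)}{\Gamma(a+1/2)^2}.$$
   Context: Appell's hypergeometric series is $F_1(\alpha;\beta_1,\beta_2;\gamma;x,y)=\sum_{m,n\ge0}\frac{(\alpha,m+n)(\beta_1,m)(\beta_2,n)}{(\gamma,m+n)(1,m)(1,n)}x^my^n$ for $\gamma\notin\{0,-1,-2,\dots\}$, absolutely convergent for $|x|<1$, $|y|<1$, where $(\alpha,n)=\alpha(\alpha+1)\cdots(\alpha+n-1)$, $(\alpha,0)=1$. For real $r>0$, $r^{a}=e^{a\log r}$ with real $\log r$. $1/\Gamma$ is the entire function (zero at the poles of $\Gamma$). *)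

theory Defs
  imports "HOL-Analysis.Analysis"
begin

text \<open>
  The symbol $(\alpha,n)$ is \<^term>\<open>pochhammer \<alpha> n\<close>. The double series is taken as an
  unordered sum over pairs; it converges absolutely for $|x|, |y| < 1$ and $\gamma$ not a
  nonpositive integer, and the definition is only meaningful under these conditions.
\<close>

definition appell_F1 ::
  "complex \<Rightarrow> complex \<Rightarrow> complex \<Rightarrow> complex \<Rightarrow> complex \<Rightarrow> complex \<Rightarrow> complex" where
  "appell_F1 \<alpha> \<beta>\<^sub>1 \<beta>\<^sub>2 \<gamma> x y =
    (\<Sum>\<^sub>\<infinity>(m, n) \<in> (UNIV :: (nat \<times> nat) set).
      (pochhammer \<alpha> (m + n) * pochhammer \<beta>\<^sub>1 m * pochhammer \<beta>\<^sub>2 n) /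
      (pochhammer \<gamma> (m + n) * pochhammer 1 m * pochhammer 1 n) * x ^ m * y ^ n)"

end

theory Submission
  imports Defs "HOL-Complex_Analysis.Conformal_Mappings"
begin

text \<open>
  For real \<open>a > 1/4\<close> Euler's integral turns the series into an integral over \<open>{0..1}\<close> of
  \<open>(t\<^sup>2 / (P Q\<^sup>4))\<^sup>a\<close>, where \<open>P = 1 - t/81\<close> and \<open>Q = 1 - t/6\<close>, against the form
  \<open>Q dt / (t sqrt ((1 - t) P))\<close>. Taking \<open>u = t\<^sup>2 / (s P Q\<^sup>4)\<close> with \<open>s = 3\<^sup>8 / 5\<^sup>5\<close> as the new variable, this
  form is \<open>du / (2 u sqrt (1 - u))\<close>, which leaves a Beta integral; Legendre's duplication formula
  gives the closed form. Both sides are holomorphic in \<open>a\<close> off the excluded points, so the identity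
  theorem extends the equality to all admissible complex \<open>a\<close>.
\<close>

section \<open>Binomial series as unordered sums of nonnegative terms\<close>

text \<open>In Newton's series for exponent \<open>-b\<close> at \<open>-x\<close> the signs cancel,
  so all terms are nonnegative and convergence of the partial sums already gives unordered
  summability.\<close>

lemma one_minus_powr_has_sum:
  fixes b x :: real
  assumes "b > 0" "0 \<le> x" "x < 1"
  shows "((\<lambda>m. pochhammer b m / fact m * x ^ m) has_sum (1 - x) powr (-b)) UNIV"
proof (rule sums_nonneg_imp_has_sum)
  have "(\<lambda>n. ((-b) gchoose n) * (-x) ^ n) sums (1 + (-x)) powr (-b)"
    using assms by (intro gen_binomial_real) auto
  also have "(\<lambda>n. ((-b) gchoose n) * (-x) ^ n) = (\<lambda>n. pochhammer b n / fact n * x ^ n)"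
  proof
    fix n
    have "(-x) ^ n = (-1) ^ n * x ^ n"
      by (rule power_minus)
    moreover have "(-1 :: real) ^ n * (-1) ^ n = 1"
      by (simp flip: power_mult_distrib)
    ultimately show "((-b) gchoose n) * (-x) ^ n = pochhammer b n / fact n * x ^ n"
      by (simp add: gbinomial_pochhammer mult_ac)
  qed
  finally show "(\<lambda>n. pochhammer b n / fact n * x ^ n) sums (1 - x) powr (-b)"
    by simp
  show "pochhammer b n / fact n * x ^ n \<ge> 0" for n
    using assms by (simp add: pochhammer_nonneg)
qed

lemma has_sum_mult_Times:
  fixes f :: "'a \<Rightarrow> real" and g :: "'b \<Rightarrow> real"
  assumes f: "(f has_sum S) A" and g: "(g has_sum T) B"
    and nonneg: "\<And>x. x \<in> A \<Longrightarrow> f x \<ge> 0" "\<And>y. y \<in> B \<Longrightarrow> g y \<ge> 0"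
  shows "((\<lambda>(x, y). f x * g y) has_sum S * T) (A \<times> B)"
proof (rule has_sum_SigmaI)
  show inner: "((\<lambda>y. case (x, y) of (x, y) \<Rightarrow> f x * g y) has_sum f x * T) B" for x
    unfolding case_prod_conv by (rule has_sum_cmult_right[OF g])
  show outer: "((\<lambda>x. f x * T) has_sum S * T) A"
    by (rule has_sum_cmult_left[OF f])
  show "(\<lambda>(x, y). f x * g y) summable_on A \<times> B"
    by (rule summable_on_SigmaI[OF inner]) (use nonneg outer in \<open>auto simp: summable_on_def\<close>)
qed

text \<open>Turns sums into integrals over a counting measure, the form in which Tonelli's theorem
  exchanges them with the integral over \<open>{0..1}\<close>.\<close>

lemma nn_integral_count_space_has_sum:
  fixes f :: "'a \<Rightarrow> real"
  assumes "(f has_sum S) A" "\<And>x. x \<in> A \<Longrightarrow> f x \<ge> 0"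
  shows "(\<integral>\<^sup>+x. ennreal (f x) \<partial>count_space A) = ennreal S"
proof -
  have "(\<lambda>x. norm (f x)) summable_on A \<longleftrightarrow> f summable_on A"
    using assms(2) by (intro summable_on_cong) auto
  hence abs: "Infinite_Set_Sum.abs_summable_on f A"
    using assms(1) by (auto simp: summable_on_def simp flip: abs_summable_equivalent)
  show ?thesis
    using nn_integral_conv_infsetsum[OF abs assms(2)] infsumI[OF assms(1)]
    by (simp add: infsetsum_infsum[OF abs])
qed

text \<open>Serves twice: with enlarged arguments as a summable majorant of the Appell series, and
  at \<open>x * t\<close>, \<open>y * t\<close> as the expansion of Euler's integrand.\<close>

lemma binomial_product_has_sum:
  fixes b c x y :: real
  assumes "b > 0" "c > 0" "0 \<le> x" "x < 1" "0 \<le> y" "y < 1"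
  shows "((\<lambda>(m, n). (pochhammer b m / fact m * x ^ m) * (pochhammer c n / fact n * y ^ n))
    has_sum (1 - x) powr (-b) * (1 - y) powr (-c)) UNIV"
  using has_sum_mult_Times[OF one_minus_powr_has_sum[of b x] one_minus_powr_has_sum[of c y]] assms
  by (simp add: pochhammer_nonneg)

section \<open>Uniform bounds on the terms, and holomorphy in the parameters\<close>

lemma norm_pochhammer_le:
  fixes z :: "'a :: real_normed_field"
  assumes "norm z \<le> B"
  shows "norm (pochhammer z n) \<le> pochhammer B n"
proof -
  have "norm (z + of_nat k) \<le> B + real k" for k
    using norm_triangle_ineq[of z "of_nat k"] assms by simp
  thus ?thesis
    by (simp add: pochhammer_prod prod_mono flip: prod_norm)
qed

text \<open>
  The factor \<open>(\<alpha> + k) / (\<gamma> + k)\<close> is at most \<open>\<rho>\<close> in norm for large \<open>k\<close>; the finitely many others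
  stay bounded as long as \<open>\<gamma>\<close> keeps a distance from the nonpositive integers.
\<close>
lemma pochhammer_ratio_bound:
  fixes \<gamma>0 :: complex and A \<rho> :: real
  assumes "\<gamma>0 \<notin> \<int>\<^sub>\<le>\<^sub>0" "\<rho> > 1"
  shows "\<exists>C r. C > 0 \<and> r > 0 \<and> (\<forall>\<alpha> \<gamma> N. norm \<alpha> \<le> A \<longrightarrow> \<gamma> \<in> cball \<gamma>0 r \<longrightarrow>
    norm (pochhammer \<alpha> N / pochhammer \<gamma> N) \<le> C * \<rho> ^ N)"
proof -
  have "open (- \<int>\<^sub>\<le>\<^sub>0 :: complex set)"
    by (simp add: open_Compl)
  then obtain e where e: "e > 0" "ball \<gamma>0 e \<subseteq> - \<int>\<^sub>\<le>\<^sub>0"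
    using assms(1) by (meson ComplI open_contains_ball)
  \<comment> \<open>Halving the radius keeps every \<open>\<gamma> + k\<close> at distance at least
    \<open>r\<close> from 0. \<open>D\<close> bounds \<open>norm (\<alpha> - \<gamma>)\<close>, so
    the factor with index \<open>k\<close> is at most \<open>1 + D / norm (\<gamma> + k)\<close>.
    This never exceeds \<open>Q\<close>, and from index \<open>K\<close> on it is at most
    \<open>\<rho>\<close>.\<close>
  define r where "r = e / 2"
  define D where "D = \<bar>A\<bar> + norm \<gamma>0 + r"
  define Q where "Q = 1 + D / r"
  obtain K :: nat where K: "real K > norm \<gamma>0 + r + D / (\<rho> - 1)"
    using reals_Archimedean2 by blast
  have r: "r > 0" and D: "D \<ge> 0"
    using e by (auto simp: r_def D_def)
  have Q: "Q \<ge> 1"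
    using r D by (simp add: Q_def)
  show ?thesis
  proof (rule exI[of _ "Q ^ K"], rule exI[of _ r], intro conjI allI impI)
    show "Q ^ K > 0" "r > 0"
      using r Q by auto
    fix \<alpha> \<gamma> :: complex and N :: nat
    assume \<alpha>: "norm \<alpha> \<le> A" and \<gamma>: "\<gamma> \<in> cball \<gamma>0 r"
    have n\<gamma>: "norm (\<gamma> - \<gamma>0) \<le> r"
      using \<gamma> by (simp add: dist_norm norm_minus_commute)
    have diff: "norm (\<alpha> - \<gamma>) \<le> D"
      using norm_triangle_ineq4[of \<alpha> \<gamma>] norm_triangle_ineq[of \<gamma>0 "\<gamma> - \<gamma>0"] \<alpha> n\<gamma>
      by (simp add: D_def)
    have low: "norm (\<gamma> + of_nat k) \<ge> r" for k
    proof -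
      have "- of_nat k \<notin> ball \<gamma>0 e"
        using e(2) by auto
      hence "norm (\<gamma>0 + of_nat k) \<ge> e"
        by (simp add: dist_norm)
      thus ?thesis
        using norm_triangle_ineq[of "\<gamma> + of_nat k" "\<gamma>0 - \<gamma>"] n\<gamma>
        by (simp add: r_def norm_minus_commute add_ac)
    qed
    have factor: "norm ((\<alpha> + of_nat k) / (\<gamma> + of_nat k)) \<le> 1 + D / norm (\<gamma> + of_nat k)" for k
    proof -
      have nz: "norm (\<gamma> + of_nat k) > 0"
        using low[of k] r by linarith
      have "norm (\<alpha> + of_nat k) \<le> norm (\<gamma> + of_nat k) + D"
        using norm_triangle_ineq[of "\<gamma> + of_nat k" "\<alpha> - \<gamma>"] diff by (simp add: add_ac)
      thus ?thesis
        using nz by (auto simp: norm_divide field_simps)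
    qed
    have small: "norm ((\<alpha> + of_nat k) / (\<gamma> + of_nat k)) \<le> Q" for k
    proof -
      have "D / norm (\<gamma> + of_nat k) \<le> D / r"
        using low[of k] r D by (intro divide_left_mono mult_pos_pos) linarith+
      thus ?thesis
        using factor[of k] by (simp add: Q_def)
    qed
    have large: "norm ((\<alpha> + of_nat k) / (\<gamma> + of_nat k)) \<le> \<rho>" if "k \<ge> K" for k
    proof -
      have "real k \<le> norm (\<gamma> + of_nat k) + norm \<gamma>0 + r"
        using norm_triangle_ineq4[of "\<gamma> + of_nat k" \<gamma>] norm_triangle_ineq[of \<gamma>0 "\<gamma> - \<gamma>0"] n\<gamma>
        by simp
      hence *: "D / (\<rho> - 1) \<le> norm (\<gamma> + of_nat k)"
        using K that by linarith
      have "norm (\<gamma> + of_nat k) > 0"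
        using low[of k] r by linarith
      moreover have "D \<le> norm (\<gamma> + of_nat k) * (\<rho> - 1)"
        using * assms(2) by (simp add: pos_divide_le_eq)
      ultimately have "D / norm (\<gamma> + of_nat k) \<le> \<rho> - 1"
        by (simp add: pos_divide_le_eq mult.commute del: zero_less_norm_iff)
      thus ?thesis
        using factor[of k] by linarith
    qed
    \<comment> \<open>The exponent \<open>min n K\<close> counts the factors with index below
      \<open>K\<close>, the only ones charged with \<open>Q\<close>.\<close>
    have "norm (pochhammer \<alpha> n / pochhammer \<gamma> n) \<le> Q ^ min n K * \<rho> ^ n" for n
    proof (induction n)
      case (Suc n)
      have step: "norm ((\<alpha> + of_nat n) / (\<gamma> + of_nat n)) \<le> (if n < K then Q else 1) * \<rho>"
      proof (cases "n < K")
        case True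
        have "Q * 1 \<le> Q * \<rho>"
          using Q assms(2) by (intro mult_left_mono) auto
        thus ?thesis
          using small[of n] True by simp
      qed (use large[of n] in auto)
      have "norm (pochhammer \<alpha> (Suc n) / pochhammer \<gamma> (Suc n)) =
          norm (pochhammer \<alpha> n / pochhammer \<gamma> n) * norm ((\<alpha> + of_nat n) / (\<gamma> + of_nat n))"
        by (simp add: pochhammer_Suc norm_mult norm_divide)
      also have "\<dots> \<le> (Q ^ min n K * \<rho> ^ n) * ((if n < K then Q else 1) * \<rho>)"
        using Q assms(2) by (intro mult_mono Suc.IH step) auto
      also have "\<dots> = Q ^ min (Suc n) K * \<rho> ^ Suc n"
        by (cases "n < K") (simp_all add: min_absorb1 min_absorb2 Suc_le_eq not_less)
      finally show ?case .
    qed auto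
    from this[of N] show "norm (pochhammer \<alpha> N / pochhammer \<gamma> N) \<le> Q ^ K * \<rho> ^ N"
      by (rule order_trans) (use Q assms(2) in \<open>auto intro!: mult_right_mono power_increasing\<close>)
  qed
qed

definition appell_term ::
  "complex \<Rightarrow> complex \<Rightarrow> complex \<Rightarrow> complex \<Rightarrow> complex \<Rightarrow> complex \<Rightarrow> nat \<times> nat \<Rightarrow> complex" where
  "appell_term \<alpha> b c \<gamma> x y = (\<lambda>(m, n).
     (pochhammer \<alpha> (m + n) * pochhammer b m * pochhammer c n) /
     (pochhammer \<gamma> (m + n) * pochhammer 1 m * pochhammer 1 n) * x ^ m * y ^ n)"

lemma appell_F1_eq_infsum: "appell_F1 \<alpha> b c \<gamma> x y = infsum (appell_term \<alpha> b c \<gamma> x y) UNIV"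
  by (simp add: appell_F1_def appell_term_def)

text \<open>The ratio of the two symbols of index \<open>m + n\<close> costs
  \<open>C * \<rho> ^ (m + n)\<close>, which is absorbed into the powers of \<open>x\<close> and
  \<open>y\<close>; what remains is a product of two binomial series. The majorant does not depend
  on the parameters, so it yields both absolute convergence and a Weierstrass test.\<close>

lemma appell_term_bound:
  fixes \<gamma>0 x y :: complex and B :: real
  assumes "\<gamma>0 \<notin> \<int>\<^sub>\<le>\<^sub>0" "norm x < 1" "norm y < 1" "B > 0"
  shows "\<exists>r M. r > 0 \<and> M summable_on UNIV \<and>
    (\<forall>\<alpha> b c \<gamma> p. norm \<alpha> \<le> B \<longrightarrow> norm b \<le> B \<longrightarrow> norm c \<le> B \<longrightarrow> \<gamma> \<in> cball \<gamma>0 r \<longrightarrow>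
       norm (appell_term \<alpha> b c \<gamma> x y p) \<le> M p)"
proof -
  define q where "q = max (norm x) (norm y)"
  \<comment> \<open>Any \<open>\<rho>\<close> with \<open>1 < \<rho>\<close> and
    \<open>\<rho> * q < 1\<close> would do; this choice also covers \<open>q = 0\<close>.\<close>
  define \<rho> where "\<rho> = 2 / (1 + q)"
  have q: "0 \<le> q" "q < 1" "norm x \<le> q" "norm y \<le> q"
    using assms by (auto simp: q_def le_max_iff_disj)
  have \<rho>: "\<rho> > 1" "\<rho> * q < 1"
    using q by (simp_all add: \<rho>_def less_divide_eq divide_less_eq)
  have xy: "\<rho> * norm x < 1" "\<rho> * norm y < 1"
    using \<rho> q by (auto intro!: le_less_trans[OF mult_left_mono \<rho>(2)])
  obtain C r where C: "C > 0" "r > 0" and bound: "\<forall>\<alpha> \<gamma> N. norm \<alpha> \<le> B \<longrightarrow> \<gamma> \<in> cball \<gamma>0 r \<longrightarrow>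
       norm (pochhammer \<alpha> N / pochhammer \<gamma> N) \<le> C * \<rho> ^ N"
    using pochhammer_ratio_bound[OF assms(1) \<rho>(1), of B] by (elim exE conjE) (rule that)
  define h where "h = (\<lambda>(m, n). (pochhammer B m / fact m * (\<rho> * norm x) ^ m) *
                                (pochhammer B n / fact n * (\<rho> * norm y) ^ n))"
  show ?thesis
  proof (rule exI[of _ r], rule exI[of _ "\<lambda>p. C * h p"], intro conjI allI impI)
    show "r > 0"
      by fact
    have "h summable_on UNIV"
      using binomial_product_has_sum[of B B "\<rho> * norm x" "\<rho> * norm y"] assms(4) xy \<rho>(1)
      unfolding h_def by (auto simp: summable_on_def)
    thus "(\<lambda>p. C * h p) summable_on UNIV"
      by (rule summable_on_cmult_right)
    fix \<alpha> b c \<gamma> :: complex and p :: "nat \<times> nat"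
    assume le: "norm \<alpha> \<le> B" "norm b \<le> B" "norm c \<le> B" "\<gamma> \<in> cball \<gamma>0 r"
    obtain m n where p: "p = (m, n)"
      by force
    have "norm (appell_term \<alpha> b c \<gamma> x y p) = norm (pochhammer \<alpha> (m + n) / pochhammer \<gamma> (m + n)) *
        (norm (pochhammer b m) / fact m * norm x ^ m) * (norm (pochhammer c n) / fact n * norm y ^ n)"
      by (simp add: appell_term_def p norm_mult norm_divide norm_power flip: pochhammer_fact)
    also have "\<dots> \<le> (C * \<rho> ^ (m + n)) * (pochhammer B m / fact m * norm x ^ m) *
        (pochhammer B n / fact n * norm y ^ n)"
      using C \<rho> le assms(4)
      by (intro mult_mono divide_right_mono norm_pochhammer_le bound[rule_format])
         (auto intro!: mult_nonneg_nonneg divide_nonneg_nonneg pochhammer_nonneg)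
    also have "\<dots> = C * h p"
      by (simp add: h_def p power_add power_mult_distrib mult_ac)
    finally show "norm (appell_term \<alpha> b c \<gamma> x y p) \<le> C * h p" .
  qed
qed

lemma appell_term_norm_summable:
  assumes "\<gamma> \<notin> \<int>\<^sub>\<le>\<^sub>0" "norm x < 1" "norm y < 1"
  shows "(\<lambda>p. norm (appell_term \<alpha> b c \<gamma> x y p)) summable_on UNIV"
proof -
  define B where "B = norm \<alpha> + norm b + norm c + 1"
  have B: "B > 0"
    by (simp add: B_def add_nonneg_pos)
  obtain r M where M: "r > 0" "M summable_on UNIV"
    "\<forall>\<alpha> b c \<gamma>' p. norm \<alpha> \<le> B \<longrightarrow> norm b \<le> B \<longrightarrow> norm c \<le> B \<longrightarrow> \<gamma>' \<in> cball \<gamma> r \<longrightarrow>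
       norm (appell_term \<alpha> b c \<gamma>' x y p) \<le> M p"
    using appell_term_bound[OF assms B] by (elim exE conjE) (rule that)
  have "norm (appell_term \<alpha> b c \<gamma> x y p) \<le> M p" for p
    by (rule M(3)[rule_format]) (use M(1) in \<open>simp_all add: B_def\<close>)
  thus ?thesis
    by (intro summable_on_comparison_test[OF M(2)] norm_ge_zero)
qed

text \<open>Finite partial sums are holomorphic and, by the majorant, converge uniformly on a closed
  ball around each point of \<open>S\<close>; so the limit is holomorphic near each point.\<close>

lemma appell_F1_holomorphic:
  fixes \<alpha> b c \<gamma> :: "complex \<Rightarrow> complex"
  assumes "open S" "\<alpha> holomorphic_on S" "b holomorphic_on S" "c holomorphic_on S"
    "\<gamma> holomorphic_on S" "\<And>z. z \<in> S \<Longrightarrow> \<gamma> z \<notin> \<int>\<^sub>\<le>\<^sub>0" "norm x < 1" "norm y < 1"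
  shows "(\<lambda>z. appell_F1 (\<alpha> z) (b z) (c z) (\<gamma> z) x y) holomorphic_on S"
proof -
  let ?t = "\<lambda>p z. appell_term (\<alpha> z) (b z) (c z) (\<gamma> z) x y p"
  have "\<exists>e>0. (\<lambda>z. infsum (\<lambda>p. ?t p z) UNIV) holomorphic_on ball z0 e" if z0: "z0 \<in> S" for z0
  proof -
    \<comment> \<open>The added 1 makes the three bounds strict at \<open>z0\<close>, so that by
      continuity they persist nearby.\<close>
    define B where "B = norm (\<alpha> z0) + norm (b z0) + norm (c z0) + 1"
    have B: "B > 0"
      by (simp add: B_def add_nonneg_pos)
    obtain r M where M: "r > 0" "M summable_on UNIV"
      "\<forall>\<alpha> b c \<gamma>' p. norm \<alpha> \<le> B \<longrightarrow> norm b \<le> B \<longrightarrow> norm c \<le> B \<longrightarrow> \<gamma>' \<in> cball (\<gamma> z0) r \<longrightarrow>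
         norm (appell_term \<alpha> b c \<gamma>' x y p) \<le> M p"
      using appell_term_bound[OF assms(6)[OF z0] assms(7,8) B] by (elim exE conjE) (rule that)
    have ev: "eventually (\<lambda>z. norm (f z) < B) (nhds z0)"
      if f: "f holomorphic_on S" and lt: "norm (f z0) < B" for f :: "complex \<Rightarrow> complex"
    proof -
      have "isCont f z0"
        using f assms(1) z0 by (meson continuous_on_eq_continuous_at holomorphic_on_imp_continuous_on)
      hence "(f \<longlongrightarrow> f z0) (nhds z0)"
        by (simp add: isCont_def tendsto_at_iff_tendsto_nhds)
      hence "((\<lambda>z. norm (f z)) \<longlongrightarrow> norm (f z0)) (nhds z0)"
        by (rule tendsto_norm)
      thus ?thesis
        using lt by (rule order_tendstoD)
    qed
    have "isCont \<gamma> z0"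
      using assms(1,5) z0 by (meson continuous_on_eq_continuous_at holomorphic_on_imp_continuous_on)
    hence "(\<gamma> \<longlongrightarrow> \<gamma> z0) (nhds z0)"
      by (simp add: isCont_def tendsto_at_iff_tendsto_nhds)
    hence ev\<gamma>: "eventually (\<lambda>z. dist (\<gamma> z) (\<gamma> z0) < r) (nhds z0)"
      using M(1) by (rule tendstoD)
    have "eventually (\<lambda>z. z \<in> S) (nhds z0)"
      using assms(1) z0 by (rule eventually_nhds_in_open)
    hence "eventually (\<lambda>z. norm (\<alpha> z) < B \<and> norm (b z) < B \<and> norm (c z) < B \<and>
        dist (\<gamma> z) (\<gamma> z0) < r \<and> z \<in> S) (nhds z0)"
      using assms(2-4) ev\<gamma>
      by (intro eventually_conj ev) (auto simp: B_def add_nonneg_pos add_strict_increasing2)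
    then obtain d where d: "d > 0" "\<And>z. dist z z0 < d \<Longrightarrow> norm (\<alpha> z) < B \<and> norm (b z) < B \<and>
        norm (c z) < B \<and> dist (\<gamma> z) (\<gamma> z0) < r \<and> z \<in> S"
      by (auto simp: eventually_nhds_metric)
    define e where "e = d / 2"
    have e: "e > 0"
      using d(1) by (simp add: e_def)
    have near: "norm (\<alpha> z) \<le> B \<and> norm (b z) \<le> B \<and> norm (c z) \<le> B \<and> \<gamma> z \<in> cball (\<gamma> z0) r \<and> z \<in> S"
      if "z \<in> cball z0 e" for z
      using d(2)[of z] that d(1) by (auto simp: e_def dist_commute)
    have ulim: "uniform_limit (cball z0 e) (\<lambda>X z. \<Sum>p\<in>X. ?t p z) (\<lambda>z. infsum (\<lambda>p. ?t p z) UNIV)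
        (finite_subsets_at_top UNIV)"
      by (rule Weierstrass_m_test_general[OF _ M(2)]) (use near M(3)[rule_format] in simp)
    have sub: "cball z0 e \<subseteq> S"
      using near by blast
    have holt: "?t p holomorphic_on cball z0 e" for p
    proof -
      obtain m n where p: "p = (m, n)"
        by force
      have "pochhammer (\<gamma> z) k \<noteq> 0" if "z \<in> S" for z k
        using assms(6)[OF that] by (auto simp: pochhammer_eq_0_iff)
      thus ?thesis
        unfolding p appell_term_def case_prod_conv
        by (intro holomorphic_intros holomorphic_on_subset[OF _ sub] assms)
           (use sub in \<open>auto simp: pochhammer_fact [symmetric]\<close>)
    qed
    have "eventually (\<lambda>X. continuous_on (cball z0 e) (\<lambda>z. \<Sum>p\<in>X. ?t p z) \<and>
        (\<lambda>z. \<Sum>p\<in>X. ?t p z) holomorphic_on ball z0 e) (finite_subsets_at_top UNIV)"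
      by (intro always_eventually allI conjI holomorphic_on_imp_continuous_on holomorphic_on_sum
          holt holomorphic_on_subset[OF holt ball_subset_cball])
    then have "(\<lambda>z. infsum (\<lambda>p. ?t p z) UNIV) holomorphic_on ball z0 e"
      by (rule holomorphic_uniform_limit[OF _ ulim]) auto
    thus ?thesis
      using e by blast
  qed
  hence "(\<lambda>z. infsum (\<lambda>p. ?t p z) UNIV) holomorphic_on S"
    by (meson assms(1) centre_in_ball holomorphic_on_imp_differentiable_at open_ball
        field_differentiable_at_within holomorphic_on_def)
  thus ?thesis
    by (simp add: appell_F1_eq_infsum)
qed

section \<open>Euler's integral for positive parameters\<close>

text \<open>The functional equation of Gamma, applied \<open>N\<close> times to both Gamma factors
  that contain \<open>\<alpha>\<close>. It is the source of the coefficient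
  \<open>(\<alpha>, m + n) / (\<gamma>, m + n)\<close> when Euler's integrand is integrated term by
  term.\<close>

lemma Beta_add_of_nat:
  fixes \<alpha> \<delta> :: real
  assumes "\<alpha> > 0" "\<delta> > 0"
  shows "Beta (\<alpha> + real N) \<delta> = Beta \<alpha> \<delta> * (pochhammer \<alpha> N / pochhammer (\<alpha> + \<delta>) N)"
proof -
  have "\<alpha> \<notin> \<int>\<^sub>\<le>\<^sub>0" "\<alpha> + \<delta> \<notin> \<int>\<^sub>\<le>\<^sub>0"
    using assms by (auto dest: nonpos_Ints_nonpos)
  moreover have "Gamma \<alpha> > 0" "Gamma (\<alpha> + \<delta>) > 0" "Gamma (\<alpha> + \<delta> + real N) > 0"
    using assms by (auto intro!: Gamma_real_pos)
  ultimately show ?thesis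
    by (simp add: Beta_def pochhammer_Gamma field_simps add_ac)
qed

lemma nn_integral_Beta:
  fixes a b :: real
  assumes "a > 0" "b > 0"
  shows "(\<integral>\<^sup>+t. ennreal (t powr (a - 1) * (1 - t) powr (b - 1)) * indicator {0..1} t \<partial>lborel) =
    ennreal (Beta a b)"
  using assms by (intro nn_integral_has_integral_lebesgue' has_integral_Beta_real) auto

text \<open>
  With positive parameters all terms of the series are nonnegative, so Tonelli's theorem allows the
  interchange of sum and integral.
\<close>
lemma appell_F1_Euler_integral:
  fixes \<alpha> \<delta> b c x y :: real
  assumes pos: "\<alpha> > 0" "\<delta> > 0" "b > 0" "c > 0" and xy: "0 \<le> x" "x < 1" "0 \<le> y" "y < 1"
  obtains F where "F \<ge> 0" "appell_F1 \<alpha> b c (\<alpha> + \<delta>) x y = of_real F"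
    "(\<integral>\<^sup>+t. ennreal (t powr (\<alpha> - 1) * (1 - t) powr (\<delta> - 1) *
        ((1 - x * t) powr (-b) * (1 - y * t) powr (-c))) * indicator {0..1} t \<partial>lborel) =
     ennreal (Beta \<alpha> \<delta> * F)"
proof -
  \<comment> \<open>\<open>w p * t ^ N p\<close> is a term in the expansion of the two binomial
    factors at \<open>x * t\<close> and \<open>y * t\<close>; \<open>T p\<close> is the real value
    of the corresponding Appell term.\<close>
  define w where "w = (\<lambda>(m, n). (pochhammer b m / fact m * x ^ m) * (pochhammer c n / fact n * y ^ n))"
  define T where "T = (\<lambda>(m, n). pochhammer \<alpha> (m + n) / pochhammer (\<alpha> + \<delta>) (m + n) * w (m, n))"
  define k where "k = (\<lambda>t. t powr (\<alpha> - 1) * (1 - t) powr (\<delta> - 1))"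
  define N where "N = (\<lambda>(m, n). m + n :: nat)"
  have w0: "w p \<ge> 0" for p
    using pos xy by (auto simp: w_def pochhammer_nonneg split: prod.splits)
  have T0: "T p \<ge> 0" for p
    using pos w0 by (auto simp: T_def split: prod.splits
        intro!: mult_nonneg_nonneg divide_nonneg_nonneg pochhammer_nonneg)
  have k0: "k t \<ge> 0" for t
    by (simp add: k_def)
  have Beta0: "Beta \<alpha> \<delta> \<ge> 0"
    using pos by (simp add: Beta_def Gamma_real_pos less_imp_le)
  have term_eq: "appell_term \<alpha> b c (\<alpha> + \<delta>) x y p = of_real (T p)" for p
    by (simp add: appell_term_def T_def w_def pochhammer_of_real mult_ac split: prod.splits
        flip: pochhammer_fact of_real_add)
  have "complex_of_real (\<alpha> + \<delta>) \<notin> \<int>\<^sub>\<le>\<^sub>0"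
    using pos unfolding of_real_in_nonpos_Ints_iff by (auto dest: nonpos_Ints_nonpos)
  from appell_term_norm_summable[OF this, of x y \<alpha> b c]
  have "(\<lambda>p. norm (T p)) summable_on UNIV"
    using xy unfolding term_eq norm_of_real real_norm_def by simp
  hence T_summable: "T summable_on UNIV"
    by (rule abs_summable_summable)
  define F where "F = infsum T UNIV"
  have T_sum: "(T has_sum F) UNIV"
    unfolding F_def by (rule has_sum_infsum[OF T_summable])
  have F0: "F \<ge> 0"
    unfolding F_def by (rule infsum_nonneg) (use T0 in auto)
  have nnT: "(\<integral>\<^sup>+p. ennreal (T p) \<partial>count_space UNIV) = ennreal F"
    by (rule nn_integral_count_space_has_sum[OF T_sum T0])
  have inner: "(\<integral>\<^sup>+p. ennreal (k t * t ^ N p * w p) * indicator {0..1} t \<partial>count_space UNIV) =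
      ennreal (k t * ((1 - x * t) powr (-b) * (1 - y * t) powr (-c))) * indicator {0..1} t" for t :: real
  proof (cases "t \<in> {0..1}")
    case True
    have "x * t \<le> x * 1" "y * t \<le> y * 1"
      using True xy by (auto intro!: mult_left_mono simp del: mult_1_right)
    hence "x * t < 1" "y * t < 1" "0 \<le> x * t" "0 \<le> y * t"
      using True xy by auto
    hence "((\<lambda>p. t ^ N p * w p) has_sum (1 - x * t) powr (-b) * (1 - y * t) powr (-c)) UNIV"
      using binomial_product_has_sum[of b c "x * t" "y * t"] pos
      by (simp add: w_def N_def case_prod_unfold power_mult_distrib power_add mult_ac)
    hence hs: "((\<lambda>p. k t * t ^ N p * w p) has_sum
        k t * ((1 - x * t) powr (-b) * (1 - y * t) powr (-c))) UNIV"
      by (subst mult.assoc) (rule has_sum_cmult_right)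
    have nn: "k t * t ^ N p * w p \<ge> 0" for p
      using True w0 k0 by auto
    show ?thesis
      using nn_integral_count_space_has_sum[OF hs nn] True by simp
  qed simp
  \<comment> \<open>The factor \<open>t ^ N p\<close> only shifts the first Beta parameter by
    \<open>N p\<close>.\<close>
  have outer: "(\<integral>\<^sup>+t. ennreal (k t * t ^ N p * w p) * indicator {0..1} t \<partial>lborel) =
      ennreal (Beta \<alpha> \<delta>) * ennreal (T p)" for p
  proof -
    have "(\<integral>\<^sup>+t. ennreal (k t * t ^ N p * w p) * indicator {0..1} t \<partial>lborel) =
        (\<integral>\<^sup>+t. ennreal (w p) * (ennreal (t powr (\<alpha> + N p - 1) * (1 - t) powr (\<delta> - 1)) *
           indicator {0..1} t) \<partial>lborel)"
    proof (rule nn_integral_cong)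
      fix t :: real
      have *: "k t * t ^ N p = t powr (\<alpha> + N p - 1) * (1 - t) powr (\<delta> - 1)" if "t \<ge> 0"
      \<comment> \<open>At 0 both sides vanish by the convention
        \<open>0 powr z = 0\<close>.\<close>
      proof (cases "t = 0")
        case False
        hence "t powr (\<alpha> + N p - 1) = t powr (\<alpha> - 1) * t ^ N p"
          using that by (simp add: powr_realpow [symmetric] flip: powr_add) (simp add: algebra_simps)
        thus ?thesis
          by (simp add: k_def)
      qed (simp add: k_def)
      show "ennreal (k t * t ^ N p * w p) * indicator {0..1} t = ennreal (w p) *
          (ennreal (t powr (\<alpha> + N p - 1) * (1 - t) powr (\<delta> - 1)) * indicator {0..1} t)"
      proof (cases "t \<in> {0..1}")
        case True
        hence eq: "k t * t ^ N p * w p = w p * (t powr (\<alpha> + N p - 1) * (1 - t) powr (\<delta> - 1))"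
          using * by simp
        show ?thesis
          unfolding eq using True by (simp add: ennreal_mult'[OF w0[of p]])
      qed simp
    qed
    also have "\<dots> = ennreal (w p) * ennreal (Beta (\<alpha> + N p) \<delta>)"
      using pos by (subst nn_integral_cmult) (auto simp: nn_integral_Beta add_pos_nonneg)
    also have "\<dots> = ennreal (Beta \<alpha> \<delta>) * ennreal (T p)"
      using w0[of p] Beta0 by (simp add: T_def N_def Beta_add_of_nat[OF pos(1,2)] mult_ac
          split: prod.splits flip: ennreal_mult')
    finally show ?thesis .
  qed
  have "(\<integral>\<^sup>+t. ennreal (k t * ((1 - x * t) powr (-b) * (1 - y * t) powr (-c))) *
      indicator {0..1} t \<partial>lborel) =
      (\<integral>\<^sup>+t. \<integral>\<^sup>+p. ennreal (k t * t ^ N p * w p) * indicator {0..1} t \<partial>count_space UNIV \<partial>lborel)"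
    by (simp only: inner)
  also have "\<dots> = (\<integral>\<^sup>+p. \<integral>\<^sup>+t. ennreal (k t * t ^ N p * w p) * indicator {0..1} t \<partial>lborel \<partial>count_space UNIV)"
    unfolding k_def by (rule nn_integral_count_space_nn_integral) auto
  also have "\<dots> = ennreal (Beta \<alpha> \<delta>) * ennreal F"
    by (simp add: outer nn_integral_cmult nnT)
  also have "\<dots> = ennreal (Beta \<alpha> \<delta> * F)"
    using Beta0 by (simp add: ennreal_mult')
  finally have int: "(\<integral>\<^sup>+t. ennreal (k t * ((1 - x * t) powr (-b) * (1 - y * t) powr (-c))) *
      indicator {0..1} t \<partial>lborel) = ennreal (Beta \<alpha> \<delta> * F)" .
  have "infsum (\<lambda>p. complex_of_real (T p)) UNIV = of_real F"
    using has_sum_of_real[OF T_sum] by (rule infsumI)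
  hence "appell_F1 \<alpha> b c (\<alpha> + \<delta>) x y = of_real F"
    by (simp only: appell_F1_eq_infsum ext[OF term_eq])
  from F0 this int[unfolded k_def] show thesis
    by (rule that)
qed


section \<open>The algebraic substitution\<close>

text \<open>
  The function \<open>1 - u\<close> has double zeros at the critical points of \<open>u\<close> other than \<open>0\<close>, that is
  \<open>1 - u = (1 - t) R\<^sup>2 / (P Q\<^sup>4)\<close>, so the factor \<open>R\<close> of the derivative cancels.
\<close>
lemma Euler_integrand_substitution:
  fixes a :: real
  assumes "a > 0"
  shows "(\<integral>\<^sup>+t. ennreal (t powr (2 * a - 1) * (1 - t) powr (1 / 2 - 1) *
      ((1 - 1 / 81 * t) powr (-(a + 1 / 2)) * (1 - 1 / 6 * t) powr (-(4 * a - 1)))) *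
      indicator {0..1} t \<partial>lborel) =
    ennreal ((6561 / 3125) powr a / 2 * Beta a (1 / 2))"
proof -
  \<comment> \<open>\<open>s\<close> is the value of \<open>t\<^sup>2 / (P Q\<^sup>4)\<close> at
    \<open>t = 1\<close>, so \<open>g\<close> maps the endpoints 0 and 1 to themselves.
    \<open>R\<close> comes from the logarithmic derivative
    \<open>g' / g = 2 R / (t P Q)\<close>.\<close>
  define s :: real where "s = 6561 / 3125"
  define P Q R :: "real \<Rightarrow> real"
    where "P = (\<lambda>t. 1 - 1 / 81 * t)" and "Q = (\<lambda>t. 1 - 1 / 6 * t)"
      and "R = (\<lambda>t. 1 + 52 / 324 * t - t ^ 2 / 324)"
  define g where "g = (\<lambda>t. t ^ 2 / (s * P t * Q t ^ 4))"
  define g' where "g' = (\<lambda>t. 2 * t * R t / (s * P t ^ 2 * Q t ^ 5))"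
  define f where "f = (\<lambda>u :: real. u powr (a - 1) * (1 - u) powr (1 / 2 - 1))"
  define h where "h = (\<lambda>t. t powr (2 * a - 1) * (1 - t) powr (1 / 2 - 1) *
      (P t powr (-(a + 1 / 2)) * Q t powr (-(4 * a - 1))))"
  have s: "s > 0"
    by (simp add: s_def)
  have pos: "P t > 0" "Q t > 0" "R t > 0" if "t \<in> {0..1}" for t
  proof -
    have "t ^ 2 \<le> 1"
      using that by (simp add: power_le_one)
    thus "P t > 0" "Q t > 0" "R t > 0"
      using that by (auto simp: P_def Q_def R_def)
  qed
  have deriv: "(g has_real_derivative g' t) (at t)" if t: "t \<in> {0..1}" for t
  proof -
    have dP: "(P has_real_derivative - (1 / 81)) (at t)"
      unfolding P_def by (auto intro!: derivative_eq_intros)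
    have dQ: "(Q has_real_derivative - (1 / 6)) (at t)"
      unfolding Q_def by (auto intro!: derivative_eq_intros)
    define D' where "D' = s * (- (1 / 81)) * Q t ^ 4 + s * P t * (4 * Q t ^ 3 * (- (1 / 6)))"
    have dD: "((\<lambda>t. s * P t * Q t ^ 4) has_real_derivative D') (at t)"
      unfolding D'_def by (auto intro!: derivative_eq_intros dP dQ)
    have nz: "s * P t * Q t ^ 4 \<noteq> 0" "P t \<noteq> 0" "Q t \<noteq> 0"
      using pos[OF t] s by auto
    have "(g has_real_derivative
        (2 * t * (s * P t * Q t ^ 4) - t ^ 2 * D') / ((s * P t * Q t ^ 4) * (s * P t * Q t ^ 4))) (at t)"
      unfolding g_def by (rule DERIV_divide[OF _ dD nz(1)]) (auto intro!: derivative_eq_intros)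
    also have "2 * t * (s * P t * Q t ^ 4) - t ^ 2 * D' =
        s * t * Q t ^ 3 * (2 * P t * Q t + t * (1 / 81) * Q t + t * (4 / 6) * P t)"
      unfolding D'_def by (simp add: algebra_simps power2_eq_square power3_eq_cube power4_eq_xxxx)
    also have "2 * P t * Q t + t * (1 / 81) * Q t + t * (4 / 6) * P t = 2 * R t"
      unfolding P_def Q_def R_def by (simp add: field_simps power2_eq_square)
    also have "s * t * Q t ^ 3 * (2 * R t) / ((s * P t * Q t ^ 4) * (s * P t * Q t ^ 4)) = g' t"
      unfolding g'_def using nz s
      by (simp add: divide_simps) (simp add: algebra_simps eval_nat_numeral)
    finally show ?thesis .
  qed
  have one_minus: "1 - g t = (1 - t) * R t ^ 2 / (P t * Q t ^ 4)" if "t \<in> {0..1}" for t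
  proof -
    have "P t = (81 - t) / 81" "Q t = (6 - t) / 6" "R t = (324 + 52 * t - t ^ 2) / 324"
      by (simp_all add: P_def Q_def R_def field_simps)
    note PQR = this
    \<comment> \<open>The constant is \<open>50000 = 80 * 5 ^ 4\<close>, the value of
      \<open>(81 - t) * (6 - t) ^ 4\<close> at \<open>t = 1\<close>.\<close>
    have "s * P t * Q t ^ 4 - t ^ 2 = ((81 - t) * (6 - t) ^ 4 - 50000 * t ^ 2) / 50000"
    proof -
      have "s * P t * Q t ^ 4 = (81 - t) * (6 - t) ^ 4 / 50000"
        unfolding PQR by (simp add: s_def power_divide)
      thus ?thesis
        by (simp add: diff_divide_distrib)
    qed
    \<comment> \<open>The identity on which the evaluation rests: the quintic vanishes at
      \<open>t = 1\<close>, and the remaining quartic is the square of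
      \<open>324 * R t\<close>.\<close>
    also have "(81 - t) * (6 - t) ^ 4 - 50000 * t ^ 2 = (1 - t) * (324 + 52 * t - t ^ 2) ^ 2"
      by (simp add: algebra_simps power2_eq_square power4_eq_xxxx)
    also have "\<dots> / 50000 = s * ((1 - t) * R t ^ 2)"
      unfolding PQR by (simp add: s_def power_divide)
    finally have "s * P t * Q t ^ 4 - t ^ 2 = s * ((1 - t) * R t ^ 2)" .
    moreover have "1 - g t = (s * P t * Q t ^ 4 - t ^ 2) / (s * P t * Q t ^ 4)"
      using pos[OF that] s by (simp add: g_def diff_divide_distrib)
    ultimately show ?thesis
      using s by (simp add: mult.assoc)
  qed
  have ends: "g 0 = 0" "g 1 = 1"
    using one_minus[of 1] by (auto simp: g_def)
  have point: "f (g t) * g' t = 2 * s powr (-a) * h t" if t: "t \<in> {0..1}" for t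
  proof -
    \<comment> \<open>At either endpoint both sides are 0, again by
      \<open>0 powr z = 0\<close>.\<close>
    consider "t = 0" | "t = 1" | "0 < t" "t < 1"
      using t by force
    thus ?thesis
    proof cases
      case 1
      thus ?thesis
        by (simp add: f_def g_def h_def)
    next
      case 2
      thus ?thesis
        by (simp add: f_def ends h_def)
    next
      case 3
      note p = 3 s pos[OF t]
      \<comment> \<open>With every factor written as an exponential, the claim becomes a linear
        identity between logarithms. The term \<open>ln (R t)\<close> drops out: the square root of
        \<open>1 - g t\<close> contributes -1 and \<open>g'\<close> contributes 1.\<close>
      have g: "g t = exp (2 * ln t - ln s - ln (P t) - 4 * ln (Q t))"
        using p by (simp add: g_def exp_diff exp_of_nat_mult[of 2, simplified] exp_of_nat_mult[of 4, simplified])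
      have g1: "1 - g t = exp (ln (1 - t) + 2 * ln (R t) - ln (P t) - 4 * ln (Q t))"
        unfolding one_minus[OF t] using p
        by (simp add: exp_diff exp_add exp_of_nat_mult[of 2, simplified] exp_of_nat_mult[of 4, simplified])
      have g': "g' t = 2 * exp (ln t + ln (R t) - ln s - 2 * ln (P t) - 5 * ln (Q t))"
        using p by (simp add: g'_def exp_diff exp_add exp_of_nat_mult[of 2, simplified]
            exp_of_nat_mult[of 5, simplified])
      have f: "f (g t) = exp ((a - 1) * (2 * ln t - ln s - ln (P t) - 4 * ln (Q t)) +
          (1 / 2 - 1) * (ln (1 - t) + 2 * ln (R t) - ln (P t) - 4 * ln (Q t)))"
        unfolding f_def g1 unfolding g
        by (simp only: powr_def exp_not_eq_zero if_False ln_exp exp_add)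
      have h: "h t = exp ((2 * a - 1) * ln t + (1 / 2 - 1) * ln (1 - t) +
          (-(a + 1 / 2)) * ln (P t) + (-(4 * a - 1)) * ln (Q t))"
      proof -
        have "t \<noteq> 0" "1 - t \<noteq> 0" "P t \<noteq> 0" "Q t \<noteq> 0"
          using p by auto
        thus ?thesis
          by (simp only: h_def powr_def if_False exp_add mult.assoc)
      qed
      have sa: "s powr (-a) = exp ((-a) * ln s)"
        using s by (simp add: powr_def)
      show ?thesis
        unfolding f g' h sa
        by (simp only: mult.left_commute[of _ 2] mult.assoc mult_exp_exp)
           (simp add: field_simps)
    qed
  qed
  have Beta_eq: "(\<integral>\<^sup>+u. ennreal (f u) * indicator {0..1} u \<partial>lborel) = ennreal (Beta a (1 / 2))"
    unfolding f_def by (rule nn_integral_Beta) (use assms in auto)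
  \<comment> \<open>Positivity of \<open>R\<close> makes \<open>g'\<close> nonnegative, as the
    change of variables requires. The integrands may be unbounded near the endpoints, which is
    harmless for integrals of nonnegative functions.\<close>
  have "(\<integral>\<^sup>+u. ennreal (f u * indicator {g 0..g 1} u) \<partial>lborel) =
      (\<integral>\<^sup>+t. ennreal (f (g t) * g' t * indicator {0..1} t) \<partial>lborel)"
  proof (rule nn_integral_substitution)
    show "set_borel_measurable borel {g 0..g 1} f"
      unfolding set_borel_measurable_def f_def by measurable
    show "continuous_on {0..1} g'"
      unfolding g'_def using pos s
      by (intro continuous_intros) (force simp: P_def Q_def R_def intro!: continuous_intros)+
    show "g' t \<ge> 0" if "t \<in> {0..1}" for t
      using pos[OF that] s that by (auto simp: g'_def intro!: divide_nonneg_nonneg mult_nonneg_nonneg)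
  qed (use deriv in auto)
  also have "(\<lambda>t. ennreal (f (g t) * g' t * indicator {0..1} t)) =
      (\<lambda>t. ennreal (2 * s powr (-a)) * (ennreal (h t) * indicator {0..1} t))"
  proof
    fix t :: real
    show "ennreal (f (g t) * g' t * indicator {0..1} t) =
        ennreal (2 * s powr (-a)) * (ennreal (h t) * indicator {0..1} t)"
      using point[of t] by (auto simp: indicator_def ennreal_mult')
  qed
  also have "(\<lambda>u. ennreal (f u * indicator {g 0..g 1} u)) = (\<lambda>u. ennreal (f u) * indicator {0..1} u)"
    by (auto simp: ends indicator_def fun_eq_iff)
  also have "(\<integral>\<^sup>+t. ennreal (2 * s powr (-a)) * (ennreal (h t) * indicator {0..1} t) \<partial>lborel) =
      ennreal (2 * s powr (-a)) * (\<integral>\<^sup>+t. ennreal (h t) * indicator {0..1} t \<partial>lborel)"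
    unfolding h_def P_def Q_def by (rule nn_integral_cmult) measurable
  finally have eq: "ennreal (Beta a (1 / 2)) =
      ennreal (2 * s powr (-a)) * (\<integral>\<^sup>+t. ennreal (h t) * indicator {0..1} t \<partial>lborel)"
    unfolding Beta_eq .
  have "ennreal (s powr a / 2) * ennreal (2 * s powr (-a)) = ennreal (s powr a / 2 * (2 * s powr (-a)))"
    by (rule ennreal_mult' [symmetric]) simp
  also have "s powr a / 2 * (2 * s powr (-a)) = 1"
    using s by (simp add: powr_minus)
  finally have "(\<integral>\<^sup>+t. ennreal (h t) * indicator {0..1} t \<partial>lborel) =
      ennreal (s powr a / 2) * ennreal (Beta a (1 / 2))"
    unfolding eq by (simp flip: mult.assoc)
  also have "\<dots> = ennreal (s powr a / 2 * Beta a (1 / 2))"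
    by (rule ennreal_mult' [symmetric]) simp
  finally show ?thesis
    unfolding h_def P_def Q_def s_def .
qed

section \<open>The identity for real parameters\<close>

lemma Gamma_legendre_duplication_real:
  fixes x :: real
  assumes "x > 0"
  shows "Gamma x * Gamma (x + 1 / 2) = 2 powr (1 - 2 * x) * sqrt pi * Gamma (2 * x)"
proof -
  have "complex_of_real x \<notin> \<int>\<^sub>\<le>\<^sub>0" "complex_of_real (x + 1 / 2) \<notin> \<int>\<^sub>\<le>\<^sub>0"
    using assms unfolding of_real_in_nonpos_Ints_iff by (auto dest: nonpos_Ints_nonpos)
  hence "Gamma (complex_of_real x) * Gamma (complex_of_real (x + 1 / 2)) =
      exp (complex_of_real ((1 - 2 * x) * ln 2)) * of_real (sqrt pi) * Gamma (complex_of_real (2 * x))"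
    using Gamma_legendre_duplication[of "complex_of_real x"] by simp
  hence "complex_of_real (Gamma x * Gamma (x + 1 / 2)) =
      complex_of_real (exp ((1 - 2 * x) * ln 2) * sqrt pi * Gamma (2 * x))"
    by (simp only: Gamma_complex_of_real exp_of_real flip: of_real_mult)
  thus ?thesis
    unfolding of_real_eq_iff by (simp add: powr_def)
qed

text \<open>The bound \<open>a > 1 / 4\<close> makes \<open>4 * a - 1\<close> positive, so all
  parameters satisfy the hypotheses of Euler's integral. Comparing its two evaluations determines
  the series.\<close>

lemma appell_F1_special_value_real:
  fixes a :: real
  assumes "a > 1 / 4"
  shows "appell_F1 (2 * a) (a + 1 / 2) (4 * a - 1) (2 * a + 1 / 2) (1 / 81) (1 / 6) =
    of_real (3 powr (8 * a) / (2 powr (2 * a) * 5 powr (5 * a)) *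
      (sqrt pi * Gamma (2 * a + 1 / 2) * rGamma (a + 1 / 2) ^ 2))"
proof -
  obtain F where F: "F \<ge> 0"
    "appell_F1 (of_real (2 * a)) (of_real (a + 1 / 2)) (of_real (4 * a - 1))
      (of_real (2 * a + 1 / 2)) (of_real (1 / 81)) (of_real (1 / 6)) = of_real F"
    "(\<integral>\<^sup>+t. ennreal (t powr (2 * a - 1) * (1 - t) powr (1 / 2 - 1) *
      ((1 - 1 / 81 * t) powr (-(a + 1 / 2)) * (1 - 1 / 6 * t) powr (-(4 * a - 1)))) *
      indicator {0..1} t \<partial>lborel) = ennreal (Beta (2 * a) (1 / 2) * F)"
    by (rule appell_F1_Euler_integral[of "2 * a" "1 / 2" "a + 1 / 2" "4 * a - 1" "1 / 81" "1 / 6"])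
       (use assms in auto)
  define s :: real where "s = 6561 / 3125"
  have Gpos: "Gamma a > 0" "Gamma (2 * a) > 0" "Gamma (a + 1 / 2) > 0" "Gamma (2 * a + 1 / 2) > 0"
    using assms by (auto intro!: Gamma_real_pos)
  have "ennreal (Beta (2 * a) (1 / 2) * F) = ennreal (s powr a / 2 * Beta a (1 / 2))"
    using Euler_integrand_substitution[of a] assms unfolding F(3) s_def by simp
  \<comment> \<open>Nonnegativity of both sides is needed to pass back to the reals, since
    \<open>ennreal\<close> sends negative numbers to 0.\<close>
  moreover have "Beta (2 * a) (1 / 2) * F \<ge> 0" "s powr a / 2 * Beta a (1 / 2) \<ge> 0"
    using F(1) Gpos by (auto simp: Beta_def Gamma_one_half_real intro!: mult_nonneg_nonneg)
  ultimately have "Beta (2 * a) (1 / 2) * F = s powr a / 2 * Beta a (1 / 2)"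
    by simp
  hence "sqrt pi * (F * Gamma (2 * a) / Gamma (2 * a + 1 / 2)) =
      sqrt pi * (s powr a / 2 * (Gamma a / Gamma (a + 1 / 2)))"
    by (simp add: Beta_def Gamma_one_half_real mult_ac)
  hence "F * Gamma (2 * a) / Gamma (2 * a + 1 / 2) = s powr a / 2 * (Gamma a / Gamma (a + 1 / 2))"
    unfolding mult_cancel_left by simp
  \<comment> \<open>Extending the fraction by \<open>Gamma (a + 1 / 2)\<close> prepares the
    duplication formula and produces the square in the denominator.\<close>
  hence "F = s powr a / 2 * (Gamma a * Gamma (a + 1 / 2)) * Gamma (2 * a + 1 / 2) /
      (Gamma (2 * a) * Gamma (a + 1 / 2) ^ 2)"
    using Gpos by (simp add: field_simps power2_eq_square)
  also have "Gamma a * Gamma (a + 1 / 2) = 2 powr (1 - 2 * a) * sqrt pi * Gamma (2 * a)"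
    using assms by (intro Gamma_legendre_duplication_real) simp
  also have "2 powr (1 - 2 * a) = 2 / 2 powr (2 * a)"
    by (simp add: powr_diff)
  also have "s powr a = 3 powr (8 * a) / 5 powr (5 * a)"
  proof -
    have "s = 3 powr 8 / 5 powr 5"
      by (simp add: s_def)
    thus ?thesis
      by (simp only: powr_divide powr_powr powr_ge_zero)
  qed
  also have "3 powr (8 * a) / 5 powr (5 * a) / 2 * (2 / 2 powr (2 * a) * sqrt pi * Gamma (2 * a)) *
      Gamma (2 * a + 1 / 2) / (Gamma (2 * a) * Gamma (a + 1 / 2) ^ 2) =
    3 powr (8 * a) / (2 powr (2 * a) * 5 powr (5 * a)) *
      (sqrt pi * Gamma (2 * a + 1 / 2) * rGamma (a + 1 / 2) ^ 2)"
    using Gpos by (simp add: rGamma_inverse_Gamma field_simps)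
  finally show ?thesis
    using F(2) by simp
qed

section \<open>Analytic continuation to complex parameters\<close>

text \<open>Writing \<open>rGamma\<close> for the entire function 1/Gamma keeps the formula
  meaningful at -1/2, -3/2, ..., where the right side is 0. The excluded points are those where
  \<open>2 * a + 1 / 2\<close> is a nonpositive integer.\<close>

theorem mainTheorem5:
  fixes a :: complex
  assumes "a \<notin> {- (2 * of_nat k + 1) / 4 | k :: nat. True}"
  shows "appell_F1 (2 * a) (a + 1 / 2) (4 * a - 1) (2 * a + 1 / 2) (1 / 81) (1 / 6) =
    3 powr (8 * a) / (2 powr (2 * a) * 5 powr (5 * a)) *
    (of_real (sqrt pi) * Gamma (2 * a + 1 / 2) * rGamma (a + 1 / 2) ^ 2)"
proof -
  define S :: "complex set" where "S = {z. 2 * z + 1 / 2 \<notin> \<int>\<^sub>\<le>\<^sub>0}"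
  define f where "f = (\<lambda>z. appell_F1 (2 * z) (z + 1 / 2) (4 * z - 1) (2 * z + 1 / 2) (1 / 81) (1 / 6) -
    3 powr (8 * z) / (2 powr (2 * z) * 5 powr (5 * z)) *
    (of_real (sqrt pi) * Gamma (2 * z + 1 / 2) * rGamma (z + 1 / 2) ^ 2))"
  have S_vimage: "S = (\<lambda>z. 2 * z + 1 / 2) -` (- \<int>\<^sub>\<le>\<^sub>0)"
    by (auto simp: S_def)
  have "open S"
    unfolding S_vimage by (rule open_vimage) (auto intro!: continuous_intros)
  \<comment> \<open>Removing a countable set from the plane leaves it connected.\<close>
  have "connected S"
  proof -
    have "- S \<subseteq> (\<lambda>w. (w - 1 / 2) / 2) ` \<int>\<^sub>\<le>\<^sub>0"
    proof
      fix z
      assume "z \<in> - S"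
      thus "z \<in> (\<lambda>w. (w - 1 / 2) / 2) ` \<int>\<^sub>\<le>\<^sub>0"
        by (intro image_eqI[of _ _ "2 * z + 1 / 2"]) (auto simp: S_def)
    qed
    moreover have "countable (\<int>\<^sub>\<le>\<^sub>0 :: complex set)"
      by (rule countable_subset[OF nonpos_Ints_subset_Ints countable_int])
    ultimately have "countable (- S)"
      by (meson countable_image countable_subset)
    hence "connected (UNIV - (- S))"
      by (intro connected_open_diff_countable) auto
    thus ?thesis
      by (simp add: Compl_eq_Diff_UNIV [symmetric])
  qed
  have "f holomorphic_on S"
    unfolding f_def using \<open>open S\<close>
    by (intro holomorphic_intros appell_F1_holomorphic) (auto simp: S_def)
  \<comment> \<open>The ray on which the real case applies; it accumulates at 1, an interior point
    of \<open>S\<close>.\<close>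
  define U where "U = complex_of_real ` {1 / 4<..}"
  have real_S: "complex_of_real x \<in> S" if "x > 1 / 4" for x
  proof -
    have "complex_of_real (2 * x + 1 / 2) \<notin> \<int>\<^sub>\<le>\<^sub>0"
      using that unfolding of_real_in_nonpos_Ints_iff by (auto dest: nonpos_Ints_nonpos)
    thus ?thesis
      by (simp add: S_def)
  qed
  have limpt: "(1 :: complex) islimpt U"
  proof -
    have "(1 :: real) islimpt {1 / 4<..}"
      by (rule interior_limit_point) (simp add: interior_open)
    hence "complex_of_real 1 islimpt complex_of_real ` {1 / 4<..}"
      by (intro islimpt_isCont_image) (auto simp: eventually_at_filter)
    thus ?thesis
      by (simp add: U_def)
  qed
  have U_zero: "f z = 0" if "z \<in> U" for z
  proof -
    obtain x where x: "x > 1 / 4" "z = of_real x"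
      using \<open>z \<in> U\<close> by (auto simp: U_def)
    \<comment> \<open>Bases and factors are written as casts so that one statement covers the bases
      3, 2 and 5; for these the complex power of a real exponent is the real one.\<close>
    have powr: "of_nat n powr (of_nat m * complex_of_real x) = of_real (real n powr (real m * x))" for n m
      using powr_of_real[of "real n" "real m * x"] by simp
    have "of_real (3 powr (8 * x) / (2 powr (2 * x) * 5 powr (5 * x)) *
        (sqrt pi * Gamma (2 * x + 1 / 2) * rGamma (x + 1 / 2) ^ 2)) =
      3 powr (8 * z) / (2 powr (2 * z) * 5 powr (5 * z)) *
        (of_real (sqrt pi) * Gamma (2 * z + 1 / 2) * rGamma (z + 1 / 2) ^ 2)"
      using powr[of 3 8] powr[of 2 2] powr[of 5 5] Gamma_complex_of_real[of "2 * x + 1 / 2"]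
        rGamma_complex_of_real[of "x + 1 / 2"]
      by (simp add: x(2))
    thus ?thesis
      using appell_F1_special_value_real[OF x(1)] by (simp add: f_def x(2))
  qed
  have "a \<in> S"
  proof -
    have "a = - (2 * of_nat k + 1) / 4" if "2 * a + 1 / 2 = - of_nat k" for k
    proof -
      have "4 * a = 2 * (2 * a + 1 / 2) - 1"
        by (simp add: algebra_simps)
      also have "\<dots> = - (2 * of_nat k + 1)"
        unfolding that by simp
      finally show ?thesis
        by (simp add: field_simps)
    qed
    thus ?thesis
      using assms by (auto simp: S_def elim!: nonpos_Ints_cases')
  qed
  have "U \<subseteq> S"
    using real_S by (auto simp: U_def)
  moreover have "1 \<in> S"
    using real_S[of 1] by simp
  ultimately have "f a = 0"
    by (rule analytic_continuation[OF \<open>f holomorphic_on S\<close> \<open>open S\<close> \<open>connected S\<close> _ _ limpt U_zero \<open>a \<in> S\<close>])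
  thus ?thesis
    by (simp add: f_def)
qed

end
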